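(* Let an axis-parallel rectangle in $\mathbb{R}^2$ be tiled by $n$ axis-parallel rectangles $R_1,\dots,R_n$, where for each $i$ the ratio of the vertical side length to the horizontal side length of $R_i$ equals $p_i/q_i$ with $p_i,q_i\in\mathbb{N}^+$. Then there is a positive real $\lambda$ such that, after scaling the whole configuration by $\lambda$, the longest side of the scaled rectangle has length at most $8^{n}\prod_{i=1}^n\max\{p_i,q_i\}$ and all tiling rectangles have integer side lengths.
   Context: A tiling of a region by tiles means a finite family of closed tiles with pairwise disjoint interiors whose union is the region. *)

theory Defs
  imports "HOL-Analysis.Analysis"
begin

definition axis_rectangle :: "(real^2) set \<Rightarrow> bool" where
  "axis_rectangle S \<longleftrightarrow> (\<exists>a b. a $ 1 < b $ 1 \<and> a $ 2 < b $ 2 \<and> S = cbox a b)"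

(* Coordinate 1 is horizontal, coordinate 2 is vertical.  For a nonempty box cbox a b,
   interval_lowerbound and interval_upperbound return the corners a and b. *)

definition horizontal_side :: "(real^2) set \<Rightarrow> real" where
  "horizontal_side S = interval_upperbound S $ 1 - interval_lowerbound S $ 1"

definition vertical_side :: "(real^2) set \<Rightarrow> real" where
  "vertical_side S = interval_upperbound S $ 2 - interval_lowerbound S $ 2"

definition is_tiling :: "'i set \<Rightarrow> ('i \<Rightarrow> 'a::topological_space set) \<Rightarrow> 'a set \<Rightarrow> bool" where
  "is_tiling I R Q \<longleftrightarrow>
     finite I \<and> (\<forall>i\<in>I. closed (R i)) \<and>
     disjoint_family_on (\<lambda>i. interior (R i)) I \<and> (\<Union>i\<in>I. R i) = Q"

lemma sides_cbox:
  assumes "a $ 1 < b $ 1" "a $ 2 < b $ 2"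
  shows "horizontal_side (cbox a b) = b $ 1 - a $ 1"
    and "vertical_side (cbox a b) = b $ 2 - a $ 2"
proof -
  have "\<forall>i. a $ i \<le> b $ i"
    using assms by (simp add: forall_2)
  then have "\<forall>i\<in>Basis. a \<bullet> i \<le> b \<bullet> i"
    by (auto simp: Basis_vec_def inner_axis)
  then show "horizontal_side (cbox a b) = b $ 1 - a $ 1"
    and "vertical_side (cbox a b) = b $ 2 - a $ 2"
    by (simp_all add: horizontal_side_def vertical_side_def)
qed

end

(* Merge all horizontal edges at the same height into one vertex and regard tile i as a resistor of
   conductance q i / p i between the levels of its bottom and its top, carrying a current equal to
   its width under a voltage equal to its height.  Comparing the total width of the slices just
   below and just above a level gives Kirchhoff's current law.  With unknowns s i (the tile is
   q i * s i wide and p i * s i high) and y v (the heights of the levels), Ohm's and Kirchhoff's laws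
   form a square integer system, which is nonsingular by the energy identity.  Its determinant is
   the scaling factor: by Cramer's rule all unknowns become integers, and all determinants involved
   are bounded by the product of the absolute column sums, namely 3 * max (p i) (q i) for s i and the
   degree of v for y v.  The degrees sum to at most 2n, so k^3 <= 3^k bounds their product by
   9^(n/3), and 3 * 9^(1/3) < 8. *)
theory Submission
  imports Defs "Jordan_Normal_Form.Determinant"
begin

(* The symbol $ also denotes the components of Jordan_Normal_Form vectors. *)
notation vec_nth (infixl "$h" 90)

section \<open>Determinants and integer linear systems\<close>

text \<open>Expanding the product of column sums gives one nonnegative term for every map from
  columns to rows. The absolute Leibniz terms are those belonging to permutations.\<close>

lemma abs_det_le_prod_col_sums:
  fixes M :: "real mat"
  assumes M: "M \<in> carrier_mat n n"
  shows "\<bar>det M\<bar> \<le> (\<Prod>j = 0..<n. \<Sum>i = 0..<n. \<bar>M $$ (i, j)\<bar>)"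
proof -
  have T: "transpose_mat M \<in> carrier_mat n n" using M by simp
  let ?P = "{\<pi>. \<pi> permutes {0..<n}}"
  let ?h = "\<lambda>\<pi>. restrict \<pi> {0..<n}"
  let ?t = "\<lambda>\<pi>. \<Prod>j = 0..<n. \<bar>M $$ (\<pi> j, j)\<bar>"
  have fin: "finite ?P" by (simp add: finite_permutations)
  have "\<bar>det M\<bar> = \<bar>det (transpose_mat M)\<bar>" using det_transpose[OF M] by simp
  also have "\<dots> = \<bar>\<Sum>\<pi>\<in>?P. signof \<pi> * (\<Prod>j = 0..<n. transpose_mat M $$ (j, \<pi> j))\<bar>"
    unfolding det_def'[OF T] ..
  also have "\<dots> \<le> (\<Sum>\<pi>\<in>?P. \<bar>signof \<pi> * (\<Prod>j = 0..<n. transpose_mat M $$ (j, \<pi> j))\<bar>)"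
    by (rule sum_abs)
  also have "\<dots> = (\<Sum>\<pi>\<in>?P. ?t \<pi>)"
  proof (rule sum.cong[OF refl])
    fix \<pi> assume "\<pi> \<in> ?P"
    then have "\<pi> j < n" if "j < n" for j
      using that permutes_in_image[of \<pi> "{0..<n}" j] by auto
    then have "(\<Prod>j = 0..<n. transpose_mat M $$ (j, \<pi> j)) = (\<Prod>j = 0..<n. M $$ (\<pi> j, j))"
      using M by (intro prod.cong) auto
    then show "\<bar>signof \<pi> * (\<Prod>j = 0..<n. transpose_mat M $$ (j, \<pi> j))\<bar> = ?t \<pi>"
      by (simp add: abs_mult abs_prod sign_def)
  qed
  \<comment> \<open>A permutation is the identity outside \<open>{0..<n}\<close>, whereas the maps
    produced by expanding the product are \<open>undefined\<close> there. Restriction reconciles the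
    two and loses no information.\<close>
  also have "\<dots> = (\<Sum>\<pi>\<in>?P. ?t (?h \<pi>))"
    by (intro sum.cong prod.cong) auto
  also have "\<dots> = (\<Sum>g\<in>?h ` ?P. ?t g)"
  proof (subst sum.reindex)
    show "inj_on ?h ?P"
    proof (rule inj_onI, rule ext)
      fix \<pi> \<sigma> j assume *: "\<pi> \<in> ?P" "\<sigma> \<in> ?P" "?h \<pi> = ?h \<sigma>"
      show "\<pi> j = \<sigma> j"
      proof (cases "j \<in> {0..<n}")
        case True then show ?thesis using fun_cong[OF *(3), of j] by simp
      next
        case False then show ?thesis using *(1,2) by (simp add: permutes_def)
      qed
    qed
  qed simp
  also have "\<dots> \<le> (\<Sum>g\<in>{0..<n} \<rightarrow>\<^sub>E {0..<n}. ?t g)"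
  proof (rule sum_mono2)
    show "finite ({0..<n} \<rightarrow>\<^sub>E {0..<n})" by (simp add: finite_PiE)
    show "?h ` ?P \<subseteq> {0..<n} \<rightarrow>\<^sub>E {0..<n}"
      using permutes_in_image by fastforce
  qed (simp add: prod_nonneg)
  also have "\<dots> = (\<Prod>j = 0..<n. \<Sum>i = 0..<n. \<bar>M $$ (i, j)\<bar>)"
    by (subst prod_sum_PiE) auto
  finally show ?thesis .
qed

lemma det_in_Ints:
  fixes M :: "real mat"
  assumes M: "M \<in> carrier_mat n n" and Z: "\<And>i j. i < n \<Longrightarrow> j < n \<Longrightarrow> M $$ (i, j) \<in> \<int>"
  shows "det M \<in> \<int>"
  unfolding det_def'[OF M]
proof (intro Ints_sum Ints_mult Ints_prod)
  fix \<pi> i assume "\<pi> \<in> {\<pi>. \<pi> permutes {0..<n}}" "i \<in> {0..<n}"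
  then show "M $$ (i, \<pi> i) \<in> \<int>"
    using permutes_in_image[of \<pi> "{0..<n}" i] by (intro Z) auto
qed (auto simp: sign_def)

text \<open>Cramer's rule with \<open>D\<close> the absolute determinant: \<open>D * x c\<close> is,
  up to sign, the determinant with column \<open>c\<close> replaced by \<open>b\<close>. The
  replacement respects the same product bound because the new column has absolute sum at most 1, and
  \<open>1 \<le> B c\<close>. The assumption \<open>inj\<close> says that the kernel is trivial, so
  the determinant is nonzero.\<close>

lemma integral_system_common_denominator:
  fixes A :: "'k \<Rightarrow> 'k \<Rightarrow> real" and b x B :: "'k \<Rightarrow> real"
  assumes K: "finite K"
    and A_int: "\<And>r c. r \<in> K \<Longrightarrow> c \<in> K \<Longrightarrow> A r c \<in> \<int>"
    and b_int: "\<And>r. r \<in> K \<Longrightarrow> b r \<in> \<int>"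
    and inj: "\<And>z c. (\<And>r. r \<in> K \<Longrightarrow> (\<Sum>c\<in>K. A r c * z c) = 0) \<Longrightarrow> c \<in> K \<Longrightarrow> z c = 0"
    and col: "\<And>c. c \<in> K \<Longrightarrow> (\<Sum>r\<in>K. \<bar>A r c\<bar>) \<le> B c"
    and B1: "\<And>c. c \<in> K \<Longrightarrow> 1 \<le> B c"
    and b1: "(\<Sum>r\<in>K. \<bar>b r\<bar>) \<le> 1"
    and sol: "\<And>r. r \<in> K \<Longrightarrow> (\<Sum>c\<in>K. A r c * x c) = b r"
  obtains D where "D > 0" "D \<le> (\<Prod>c\<in>K. B c)"
    "\<And>c. c \<in> K \<Longrightarrow> D * x c \<in> \<int>" "\<And>c. c \<in> K \<Longrightarrow> \<bar>D * x c\<bar> \<le> (\<Prod>c\<in>K. B c)"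
proof -
  define n where "n = card K"
  obtain f where f: "bij_betw f {0..<n} K"
    using ex_bij_betw_nat_finite[OF K] unfolding n_def by blast
  have fK: "f i \<in> K" if "i < n" for i using f that by (auto simp: bij_betw_def)
  \<comment> \<open>The enumeration \<open>f\<close> of \<open>K\<close> turns the abstractly
    indexed system into a matrix with indices below \<open>n\<close>.\<close>
  define M where "M = mat n n (\<lambda>(i, j). A (f i) (f j))"
  define u where "u = vec n (\<lambda>j. x (f j))"
  have M: "M \<in> carrier_mat n n" and u: "u \<in> carrier_vec n"
    by (auto simp: M_def u_def)
  have mult: "(M *\<^sub>v v) $ i = (\<Sum>c\<in>K. A (f i) c * v $ the_inv_into {0..<n} f c)"
    if "v \<in> carrier_vec n" "i < n" for v i
  proof -
    have "(M *\<^sub>v v) $ i = (\<Sum>j = 0..<n. A (f i) (f j) * v $ j)"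
      using that by (auto simp: M_def scalar_prod_def)
    also have "\<dots> = (\<Sum>j = 0..<n. A (f i) (f j) * v $ the_inv_into {0..<n} f (f j))"
      using f by (intro sum.cong) (auto simp: bij_betw_def the_inv_into_f_f)
    also have "\<dots> = (\<Sum>c\<in>K. A (f i) c * v $ the_inv_into {0..<n} f c)"
      by (rule sum.reindex_bij_betw[OF f])
    finally show ?thesis .
  qed
  have inv_f: "the_inv_into {0..<n} f (f j) = j" if "j < n" for j
    using f that by (auto simp: bij_betw_def the_inv_into_f_f)
  have f_inv: "f (the_inv_into {0..<n} f c) = c" "the_inv_into {0..<n} f c < n" if "c \<in> K" for c
    using f that the_inv_into_into[of f "{0..<n}" c "{0..<n}"]
    by (auto simp: bij_betw_def f_the_inv_into_f)
  have "det M \<noteq> 0"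
  proof
    assume "det M = 0"
    then obtain v where v: "v \<in> carrier_vec n" "v \<noteq> 0\<^sub>v n" "M *\<^sub>v v = 0\<^sub>v n"
      using det_0_iff_vec_prod_zero_field[OF M] by blast
    have "v $ the_inv_into {0..<n} f c = 0" if "c \<in> K" for c
    proof (rule inj[OF _ that])
      fix r assume "r \<in> K"
      then show "(\<Sum>c\<in>K. A r c * v $ the_inv_into {0..<n} f c) = 0"
        using mult[OF v(1), of "the_inv_into {0..<n} f r"] v(3) f_inv by simp
    qed
    then have "v $ j = 0" if "j < n" for j
      using fK[OF that] inv_f[OF that] by metis
    then have "v = 0\<^sub>v n" using v(1) by (intro eq_vecI) auto
    with v(2) show False by simp
  qed
  define P where "P = (\<Prod>c\<in>K. B c)"
  have P: "P = (\<Prod>j = 0..<n. B (f j))"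
    unfolding P_def by (rule prod.reindex_bij_betw[OF f, symmetric])
  have colM: "(\<Sum>i = 0..<n. \<bar>M $$ (i, j)\<bar>) \<le> B (f j)" if "j < n" for j
  proof -
    have "(\<Sum>i = 0..<n. \<bar>M $$ (i, j)\<bar>) = (\<Sum>i = 0..<n. \<bar>A (f i) (f j)\<bar>)"
      using that by (intro sum.cong) (auto simp: M_def)
    also have "\<dots> = (\<Sum>r\<in>K. \<bar>A r (f j)\<bar>)"
      by (rule sum.reindex_bij_betw[OF f])
    finally show ?thesis using col[OF fK[OF that]] by simp
  qed
  have Mint: "M $$ (i, j) \<in> \<int>" if "i < n" "j < n" for i j
    using that A_int fK by (simp add: M_def)
  have Mu: "M *\<^sub>v u = vec n (\<lambda>i. b (f i))"
  proof (rule eq_vecI)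
    fix i assume i: "i < dim_vec (vec n (\<lambda>i. b (f i)))"
    then have "(M *\<^sub>v u) $ i = (\<Sum>c\<in>K. A (f i) c * x c)"
      by (subst mult[OF u]) (auto simp: u_def f_inv intro!: sum.cong)
    also have "\<dots> = b (f i)" using i fK by (intro sol) auto
    finally show "(M *\<^sub>v u) $ i = vec n (\<lambda>i. b (f i)) $ i" using i by simp
  qed (simp add: M_def)
  have key: "det M * x (f k) \<in> \<int> \<and> \<bar>det M * x (f k)\<bar> \<le> P" if k: "k < n" for k
  proof -
    \<comment> \<open>Since \<open>u\<close> solves the system, the inserted column is the
      right-hand side \<open>b\<close>.\<close>
    define N where "N = replace_col M (M *\<^sub>v u) k"
    have N: "N \<in> carrier_mat n n" using M by (auto simp: N_def replace_col_def)
    have Nij: "N $$ (i, j) = (if j = k then b (f i) else M $$ (i, j))" if "i < n" "j < n" for i j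
      using that M unfolding N_def Mu by (auto simp: replace_col_def)
    have "det N = det M * x (f k)"
      using cramer_lemma_mat[OF M u k] k by (simp add: N_def u_def)
    moreover have "det N \<in> \<int>"
      using Nij Mint b_int fK by (intro det_in_Ints[OF N]) auto
    moreover have "\<bar>det N\<bar> \<le> P"
    proof -
      have "(\<Sum>i = 0..<n. \<bar>N $$ (i, j)\<bar>) \<le> B (f j)" if j: "j < n" for j
      proof (cases "j = k")
        case True
        then have "(\<Sum>i = 0..<n. \<bar>N $$ (i, j)\<bar>) = (\<Sum>i = 0..<n. \<bar>b (f i)\<bar>)"
          using j Nij by (intro sum.cong) auto
        also have "\<dots> = (\<Sum>r\<in>K. \<bar>b r\<bar>)" by (rule sum.reindex_bij_betw[OF f])
        finally show ?thesis using b1 B1[OF fK[OF j]] by simp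
      next
        case False
        then have "(\<Sum>i = 0..<n. \<bar>N $$ (i, j)\<bar>) = (\<Sum>i = 0..<n. \<bar>M $$ (i, j)\<bar>)"
          using j Nij by (intro sum.cong) auto
        then show ?thesis using colM[OF j] by simp
      qed
      then have "(\<Prod>j = 0..<n. \<Sum>i = 0..<n. \<bar>N $$ (i, j)\<bar>) \<le> P"
        unfolding P by (intro prod_mono) (auto simp: sum_nonneg)
      with abs_det_le_prod_col_sums[OF N] show ?thesis by linarith
    qed
    ultimately show ?thesis by simp
  qed
  have keyK: "det M * x c \<in> \<int> \<and> \<bar>det M * x c\<bar> \<le> P" if "c \<in> K" for c
    using key[of "the_inv_into {0..<n} f c"] f_inv[OF that] by simp
  have "\<bar>det M\<bar> \<le> P"
  proof -
    have "(\<Prod>j = 0..<n. \<Sum>i = 0..<n. \<bar>M $$ (i, j)\<bar>) \<le> P"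
      unfolding P using colM by (intro prod_mono) (auto simp: sum_nonneg)
    with abs_det_le_prod_col_sums[OF M] show ?thesis by linarith
  qed
  moreover have "\<bar>det M\<bar> * x c \<in> \<int>" if "c \<in> K" for c
    using keyK[OF that] by (cases "det M \<ge> 0") (auto simp: abs_if)
  moreover have "\<bar>\<bar>det M\<bar> * x c\<bar> \<le> P" if "c \<in> K" for c
    using keyK[OF that] by (simp add: abs_mult)
  ultimately show ?thesis
    using \<open>det M \<noteq> 0\<close> by (intro that[of "\<bar>det M\<bar>"]) (auto simp: P_def)
qed

section \<open>Horizontal slices of a tiling and Kirchhoff's current law\<close>

text \<open>The tiling in coordinates: tile \<open>i\<close> is \<open>[a i, b i]\<close> times
  \<open>[c i, d i]\<close> inside \<open>[A, B]\<close> times \<open>[C, D]\<close>. Closed tiles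
  become weak inequalities in \<open>cover\<close>, interiors become strict ones in
  \<open>disj\<close>.\<close>

locale rectangle_tiling =
  fixes I :: "'i set" and a b c d :: "'i \<Rightarrow> real" and A B C D :: real
  assumes fin: "finite I"
    and AB: "A < B" and CD: "C < D"
    and ab: "\<And>i. i \<in> I \<Longrightarrow> a i < b i" and cd: "\<And>i. i \<in> I \<Longrightarrow> c i < d i"
    and cover: "\<And>x y. (\<exists>i\<in>I. a i \<le> x \<and> x \<le> b i \<and> c i \<le> y \<and> y \<le> d i) \<longleftrightarrow>
      A \<le> x \<and> x \<le> B \<and> C \<le> y \<and> y \<le> D"
    and disj: "\<And>i j x y. i \<in> I \<Longrightarrow> j \<in> I \<Longrightarrow> a i < x \<Longrightarrow> x < b i \<Longrightarrow> c i < y \<Longrightarrow> y < d i \<Longrightarrow>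
      a j < x \<Longrightarrow> x < b j \<Longrightarrow> c j < y \<Longrightarrow> y < d j \<Longrightarrow> i = j"
begin

lemma tile_bounds:
  assumes "i \<in> I"
  shows "A \<le> a i" "b i \<le> B" "C \<le> c i" "d i \<le> D"
proof -
  have "\<exists>j\<in>I. a j \<le> a i \<and> a i \<le> b j \<and> c j \<le> c i \<and> c i \<le> d j"
    using assms ab[OF assms] cd[OF assms] by (intro bexI[of _ i]) auto
  then show "A \<le> a i" "C \<le> c i" using cover by blast+
  have "\<exists>j\<in>I. a j \<le> b i \<and> b i \<le> b j \<and> c j \<le> d i \<and> d i \<le> d j"
    using assms ab[OF assms] cd[OF assms] by (intro bexI[of _ i]) auto
  then show "b i \<le> B" "d i \<le> D" using cover by blast+
qed

text \<open>A horizontal line that avoids all horizontal edges has almost every point in exactly one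
  tile that it crosses. Integrating the number of these tiles along the line gives both
  sides.\<close>

lemma sum_widths_slice:
  assumes y: "C \<le> y" "y \<le> D" and generic: "\<And>i. i \<in> I \<Longrightarrow> y \<noteq> c i \<and> y \<noteq> d i"
  shows "(\<Sum>i | i \<in> I \<and> c i < y \<and> y < d i. b i - a i) = B - A"
proof -
  let ?J = "{i \<in> I. c i < y \<and> y < d i}"
  let ?S = "a ` I \<union> b ` I"
  have J: "finite ?J" using fin by simp
  have "((\<lambda>x. \<Sum>i\<in>?J. indicator {a i..b i} x) has_integral (\<Sum>i\<in>?J. b i - a i)) {A..B}"
  proof (rule has_integral_sum[OF J])
    fix i assume i: "i \<in> ?J"
    have "((\<lambda>x. 1::real) has_integral (b i - a i)) {a i..b i}"
      using ab[of i] i has_integral_const_real[of "1::real" "a i" "b i"] by simp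
    then have "((\<lambda>x. if x \<in> {a i..b i} then 1 else 0) has_integral (b i - a i)) {A..B}"
      using tile_bounds[of i] i
      by (subst has_integral_restrict) auto
    then show "(indicator {a i..b i} has_integral (b i - a i)) {A..B}"
      by (simp add: indicator_def[abs_def] of_bool_def)
  qed
  \<comment> \<open>Only the finitely many abscissas of vertical edges are exceptional, and they do
    not affect the integral.\<close>
  moreover have "((\<lambda>x. \<Sum>i\<in>?J. indicator {a i..b i} x) has_integral (B - A)) {A..B}"
  proof (rule has_integral_spike_finite)
    show "finite ?S" using fin by simp
    show "((\<lambda>x. 1) has_integral (B - A)) {A..B}"
      using AB has_integral_const_real[of "1::real" A B] by simp
    fix x assume x: "x \<in> {A..B} - ?S"
    then obtain i where i: "i \<in> I" "a i \<le> x" "x \<le> b i" "c i \<le> y" "y \<le> d i"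
      using cover[of x y] y by auto
    have i': "a i < x" "x < b i" "c i < y" "y < d i"
      using x i generic[OF i(1)] by (auto simp: order.strict_iff_order)
    have "x \<notin> {a j..b j}" if "j \<in> ?J" "j \<noteq> i" for j
    proof
      assume "x \<in> {a j..b j}"
      then have "a j < x" "x < b j" using x that(1) by (auto simp: order.strict_iff_order)
      with disj[OF i(1) _ i', of j] that show False by auto
    qed
    then have "(\<Sum>j\<in>?J. indicator {a j..b j} x) = (\<Sum>j\<in>?J. if j = i then 1 else 0 :: real)"
      using i by (intro sum.cong) (auto simp: indicator_def)
    also have "\<dots> = 1" using J i(1) i' by simp
    finally show "(\<Sum>j\<in>?J. indicator {a j..b j} x) = (1::real)" .
  qed
  ultimately show ?thesis by (rule has_integral_unique)
qed

text \<open>The level \<open>v\<close> itself may carry edges, so the slice is taken at a height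
  \<open>y\<close> slightly below \<open>v\<close> with no edge level in between. It crosses exactly
  the tiles listed.\<close>

lemma sum_widths_below:
  assumes v: "C < v" "v \<le> D"
  shows "(\<Sum>i | i \<in> I \<and> c i < v \<and> v \<le> d i. b i - a i) = B - A"
proof -
  \<comment> \<open>Inserting \<open>C\<close> makes the maximum well defined and keeps
    \<open>y\<close> above the bottom of the rectangle.\<close>
  let ?S = "insert C {s \<in> c ` I \<union> d ` I. s < v}"
  have S: "finite ?S" using fin by simp
  have "Max ?S < v" using S v by (subst Max_less_iff) auto
  then obtain y where y: "Max ?S < y" "y < v" using dense by blast
  have less: "s < y" if "s \<in> c ` I \<union> d ` I" "s < v" for s
    using Max_ge[OF S, of s] that y by auto
  have "C < y" using Max_ge[OF S, of C] y by auto
  have c: "c i < y \<longleftrightarrow> c i < v" and d: "y < d i \<longleftrightarrow> v \<le> d i"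
    and "y \<noteq> c i \<and> y \<noteq> d i" if "i \<in> I" for i
    using less[of "c i"] less[of "d i"] y that by (auto simp: not_less[symmetric])
  then have "(\<Sum>i | i \<in> I \<and> c i < y \<and> y < d i. b i - a i) = B - A"
    using \<open>C < y\<close> y v by (intro sum_widths_slice) auto
  moreover have "{i \<in> I. c i < y \<and> y < d i} = {i \<in> I. c i < v \<and> v \<le> d i}"
    using c d by blast
  ultimately show ?thesis by simp
qed

lemma sum_widths_above:
  assumes v: "C \<le> v" "v < D"
  shows "(\<Sum>i | i \<in> I \<and> c i \<le> v \<and> v < d i. b i - a i) = B - A"
proof -
  let ?S = "insert D {s \<in> c ` I \<union> d ` I. v < s}"
  have S: "finite ?S" using fin by simp
  have "v < Min ?S" using S v by (subst Min_gr_iff) auto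
  then obtain y where y: "v < y" "y < Min ?S" using dense by blast
  have less: "y < s" if "s \<in> c ` I \<union> d ` I" "v < s" for s
    using Min_le[OF S, of s] that y by auto
  have "y < D" using Min_le[OF S, of D] y by auto
  have c: "c i < y \<longleftrightarrow> c i \<le> v" and d: "y < d i \<longleftrightarrow> v < d i"
    and "y \<noteq> c i \<and> y \<noteq> d i" if "i \<in> I" for i
    using less[of "c i"] less[of "d i"] y that by (auto simp: not_less[symmetric])
  then have "(\<Sum>i | i \<in> I \<and> c i < y \<and> y < d i. b i - a i) = B - A"
    using \<open>y < D\<close> y v by (intro sum_widths_slice) auto
  moreover have "{i \<in> I. c i < y \<and> y < d i} = {i \<in> I. c i \<le> v \<and> v < d i}"
    using c d by blast
  ultimately show ?thesis by simp
qed

text \<open>In the difference of the slices just below and just above \<open>v\<close>, tiles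
  passing through \<open>v\<close> cancel, tiles ending at \<open>v\<close> count positively and
  tiles starting there negatively. At \<open>v = D\<close> the upper slice is empty, so the whole
  width remains.\<close>

lemma kirchhoff:
  assumes v: "C < v" "v \<le> D"
  shows "(\<Sum>i\<in>I. (b i - a i) * (of_bool (d i = v) - of_bool (c i = v))) = (B - A) * of_bool (v = D)"
proof -
  have eq: "(\<Sum>i\<in>I. (b i - a i) * (of_bool (d i = v) - of_bool (c i = v))) =
    (\<Sum>i | i \<in> I \<and> c i < v \<and> v \<le> d i. b i - a i) - (\<Sum>i | i \<in> I \<and> c i \<le> v \<and> v < d i. b i - a i)"
    unfolding sum.inter_filter[OF fin] sum_subtractf[symmetric]
    using cd by (intro sum.cong) force+
  show ?thesis
  proof (cases "v = D")
    case True
    have "{i \<in> I. c i \<le> v \<and> v < d i} = {}" using True tile_bounds(4) by force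
    then have "(\<Sum>i | i \<in> I \<and> c i \<le> v \<and> v < d i. b i - a i) = 0" by (simp only: sum.empty)
    then show ?thesis using eq sum_widths_below[OF v] True by simp
  next
    case False
    then show ?thesis using eq sum_widths_below[OF v] sum_widths_above[of v] v by simp
  qed
qed

text \<open>If only bottoms lay at \<open>v\<close>, the current law there would equate a positive
  sum of widths with 0.\<close>

lemma level_is_top:
  assumes v: "v \<in> c ` I \<union> d ` I" "v \<noteq> C"
  shows "\<exists>i\<in>I. d i = v"
proof (rule ccontr)
  assume no: "\<not> (\<exists>i\<in>I. d i = v)"
  with v obtain j where j: "j \<in> I" "c j = v" by auto
  then have "C < v" "v < D" using tile_bounds[OF j(1)] cd[OF j(1)] v(2) by auto
  then have "(\<Sum>i\<in>I. (b i - a i) * (of_bool (d i = v) - of_bool (c i = v))) = 0"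
    using kirchhoff[of v] by simp
  then have "(\<Sum>i\<in>I. (b i - a i) * of_bool (c i = v)) = 0"
    using no by (simp add: sum_negf)
  moreover have "(b j - a j) * of_bool (c j = v) > 0" using j ab by simp
  then have "(\<Sum>i\<in>I. (b i - a i) * of_bool (c i = v)) > 0"
    using fin j(1) ab by (intro sum_pos2[of I j]) (auto simp: less_imp_le)
  ultimately show False by simp
qed

end

section \<open>The product of the vertex degrees\<close>

lemma sum_of_bool_mult_eq:
  fixes f :: "'v \<Rightarrow> real"
  assumes "finite V"
  shows "(\<Sum>v\<in>V. of_bool (u = v) * f v) = (if u \<in> V then f u else 0)"
  using assms by (simp add: of_bool_def if_distrib[of "\<lambda>t. t * _"] cong: if_cong)

text \<open>Every tile contributes at most one bottom and one top, so the degrees over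
  \<open>V\<close> sum to at most \<open>2 * card I\<close>; \<open>k ^ 3 \<le> 3 ^ k\<close>
  converts their product into a power of this sum. Equality in that inequality holds at
  \<open>k = 3\<close>, where its induction starts.\<close>

lemma prod_degrees_le:
  fixes c d :: "'i \<Rightarrow> 'v"
  assumes I: "finite I" and V: "finite V"
  shows "(\<Prod>v\<in>V. card {i \<in> I. c i = v} + card {i \<in> I. d i = v}) ^ 3 \<le> 9 ^ card I"
proof -
  let ?deg = "\<lambda>v. card {i \<in> I. c i = v} + card {i \<in> I. d i = v}"
  have cube: "k ^ 3 \<le> 3 ^ k" for k :: nat
  proof (cases "k \<ge> 3")
    case True
    then show ?thesis
    proof (induction k rule: dec_induct)
      case (step k)
      have "3 * (k * k) \<le> k * (k * k)" "3 * k \<le> k * k"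
        using step by (intro mult_right_mono; simp)+
      moreover have "Suc k ^ 3 = k * (k * k) + 3 * (k * k) + 3 * k + 1" "k ^ 3 = k * (k * k)"
        by (simp_all add: power3_eq_cube algebra_simps)
      ultimately have "Suc k ^ 3 \<le> 3 * k ^ 3"
        using step(1) by linarith
      with step show ?case by simp
    qed simp
  next
    case False
    then consider "k = 0" | "k = 1" | "k = 2" by linarith
    then show ?thesis by cases auto
  qed
  have fibres: "(\<Sum>v\<in>V. card {i \<in> I. e i = v}) \<le> card I" for e :: "'i \<Rightarrow> 'v"
  proof -
    have "(\<Sum>v\<in>V. card {i \<in> I. e i = v}) = card (\<Union>v\<in>V. {i \<in> I. e i = v})"
      using I V by (intro card_UN_disjoint[symmetric]) auto
    also have "\<dots> \<le> card I" using I by (intro card_mono) auto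
    finally show ?thesis .
  qed
  have "(\<Prod>v\<in>V. ?deg v) ^ 3 = (\<Prod>v\<in>V. ?deg v ^ 3)" by (rule prod_power_distrib)
  also have "\<dots> \<le> (\<Prod>v\<in>V. 3 ^ ?deg v)" by (intro prod_mono) (auto intro: cube)
  also have "\<dots> = 3 ^ (\<Sum>v\<in>V. ?deg v)" by (rule power_sum[symmetric])
  also have "\<dots> \<le> 3 ^ (2 * card I)"
    using fibres[of c] fibres[of d] by (intro power_increasing) (auto simp: sum.distrib)
  finally show ?thesis by (simp add: power_mult)
qed

section \<open>The integer network system and its solution\<close>

context rectangle_tiling
begin

text \<open>Lengths are measured in units of \<open>B - A\<close>, so that the total current is 1
  and the right-hand side of the system has a single nonzero entry, equal to 1. The common
  denominator then yields the scaling factor after division by \<open>B - A\<close>.\<close>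

lemma integral_scaling:
  fixes p q :: "'i \<Rightarrow> nat"
  assumes pq: "\<And>i. i \<in> I \<Longrightarrow> p i > 0 \<and> q i > 0"
    and ratio: "\<And>i. i \<in> I \<Longrightarrow> (d i - c i) / (b i - a i) = real (p i) / real (q i)"
  obtains l where "l > 0"
    "l * (B - A) \<le> 8 ^ card I * (\<Prod>i\<in>I. real (max (p i) (q i)))"
    "l * (D - C) \<le> 8 ^ card I * (\<Prod>i\<in>I. real (max (p i) (q i)))"
    "\<And>i. i \<in> I \<Longrightarrow> l * (b i - a i) \<in> \<int>"
    "\<And>i. i \<in> I \<Longrightarrow> l * (d i - c i) \<in> \<int>"
proof -
  \<comment> \<open>The bottom level \<open>C\<close> is grounded: its potential is 0 and its
    current equation is omitted, which makes the system square.\<close>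
  define V where "V = c ` I \<union> d ` I - {C}"
  have V: "finite V" using fin by (simp add: V_def)
  have dV: "d i \<in> V" and cV: "c i \<in> V \<longleftrightarrow> c i \<noteq> C" if "i \<in> I" for i
    using that cd[OF that] tile_bounds[OF that] by (auto simp: V_def)
  have V_range: "C < v" "v \<le> D" if "v \<in> V" for v
    using that tile_bounds cd unfolding V_def by force+
  have V_top: "\<exists>i\<in>I. d i = v" if "v \<in> V" for v
    using that level_is_top[of v] by (auto simp: V_def)
  \<comment> \<open>The corner \<open>(A, D)\<close> lies in some tile, whose top must be at
    \<open>D\<close>; hence \<open>D\<close> is a vertex.\<close>
  obtain t where t: "t \<in> I" "d t = D"
  proof -
    obtain i where i: "i \<in> I" "D \<le> d i" using cover[of A D] AB CD by auto
    then show ?thesis using tile_bounds(4)[of i] that by force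
  qed
  have DV: "D \<in> V" using dV[OF t(1)] t(2) by simp

  \<comment> \<open>\<open>inc\<close> is the incidence matrix of the network, with 1 at the top and
    -1 at the bottom of a tile.\<close>
  define inc :: "'i \<Rightarrow> real \<Rightarrow> real" where "inc i v = of_bool (d i = v) - of_bool (c i = v)" for i v
  \<comment> \<open>Rows \<open>Inl i\<close> are Ohm's law, rows \<open>Inr v\<close> the current
    law; columns \<open>Inl i\<close> belong to \<open>s i\<close>, columns \<open>Inr v\<close> to
    the potentials.\<close>
  define M :: "'i + real \<Rightarrow> 'i + real \<Rightarrow> real" where
    "M r k = (case r of
        Inl i \<Rightarrow> (case k of Inl j \<Rightarrow> real (p i) * of_bool (i = j) | Inr v \<Rightarrow> - inc i v)
      | Inr v \<Rightarrow> (case k of Inl i \<Rightarrow> real (q i) * inc i v | Inr u \<Rightarrow> 0))" for r k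
  define rhs :: "'i + real \<Rightarrow> real" where
    "rhs r = (case r of Inl i \<Rightarrow> 0 | Inr v \<Rightarrow> of_bool (v = D))" for r
  define x :: "'i + real \<Rightarrow> real" where
    "x k = (case k of Inl i \<Rightarrow> (b i - a i) / (real (q i) * (B - A)) | Inr v \<Rightarrow> (v - C) / (B - A))" for k
  define deg where "deg v = card {i \<in> I. c i = v} + card {i \<in> I. d i = v}" for v
  \<comment> \<open>Column \<open>Inl i\<close> has the entry \<open>p i\<close> and at most two
    entries of size \<open>q i\<close>, hence the factor 3. Column \<open>Inr v\<close> has at most
    one entry of size 1 for each tile edge at level \<open>v\<close>.\<close>
  define bnd :: "'i + real \<Rightarrow> real" where
    "bnd k = (case k of Inl i \<Rightarrow> 3 * real (max (p i) (q i)) | Inr v \<Rightarrow> real (deg v))" for k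
  let ?K = "I <+> V"
  have sum_K: "(\<Sum>k\<in>?K. f k) = (\<Sum>i\<in>I. f (Inl i)) + (\<Sum>v\<in>V. f (Inr v))"
    for f :: "'i + real \<Rightarrow> real"
    using sum.Plus[OF fin V, of f] by (simp add: comp_def)
  have sum_delta: "(\<Sum>j\<in>I. real (p i) * of_bool (i = j) * f j) = real (p i) * f i"
    if "i \<in> I" for i and f :: "'i \<Rightarrow> real"
    using sum_of_bool_mult_eq[OF fin, of i f] that by (simp add: mult.assoc flip: sum_distrib_left)
  \<comment> \<open>This is the voltage across tile \<open>i\<close>; the value 0 for
    \<open>c i = C\<close> is the grounded potential.\<close>
  have sum_inc: "(\<Sum>v\<in>V. inc i v * f v) = f (d i) - (if c i = C then 0 else f (c i))"
    if "i \<in> I" for i and f :: "real \<Rightarrow> real"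
    using sum_of_bool_mult_eq[OF V, of _ f] dV[OF that] cV[OF that]
    by (simp add: inc_def left_diff_distrib sum_subtractf)

  have row_Inl: "(\<Sum>k\<in>?K. M (Inl i) k * z k) =
      real (p i) * z (Inl i) - (\<Sum>v\<in>V. inc i v * z (Inr v))" if "i \<in> I" for i z
    using sum_delta[OF that, of "\<lambda>j. z (Inl j)"] by (simp add: sum_K M_def sum_negf)
  have row_Inr: "(\<Sum>k\<in>?K. M (Inr v) k * z k) = (\<Sum>i\<in>I. real (q i) * inc i v * z (Inl i))" for v z
    by (simp add: sum_K M_def)

  have sol: "(\<Sum>k\<in>?K. M r k * x k) = rhs r" if "r \<in> ?K" for r
  proof (cases r)
    case (Inl i)
    then have i: "i \<in> I" using that by auto
    have h: "d i - c i = real (p i) * (b i - a i) / real (q i)"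
      using ratio[OF i] ab[OF i] by (simp add: field_simps)
    have "(\<Sum>v\<in>V. inc i v * x (Inr v)) = (d i - c i) / (B - A)"
      unfolding sum_inc[OF i] by (simp add: x_def diff_divide_distrib)
    then show ?thesis
      unfolding Inl row_Inl[OF i] by (simp add: h rhs_def x_def)
  next
    case (Inr v)
    then have v: "v \<in> V" using that by auto
    have "(\<Sum>i\<in>I. real (q i) * inc i v * x (Inl i)) = (\<Sum>i\<in>I. (b i - a i) * inc i v) / (B - A)"
      unfolding sum_divide_distrib
    proof (rule sum.cong[OF refl])
      fix i assume "i \<in> I"
      then show "real (q i) * inc i v * x (Inl i) = (b i - a i) * inc i v / (B - A)"
        using pq[of i] by (simp add: x_def)
    qed
    also have "\<dots> = of_bool (v = D)"
      using kirchhoff[OF V_range[OF v]] AB by (simp add: inc_def)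
    finally show ?thesis unfolding Inr row_Inr by (simp add: rhs_def)
  qed

  have inj: "z k = 0" if z: "\<And>r. r \<in> ?K \<Longrightarrow> (\<Sum>k\<in>?K. M r k * z k) = 0" and k: "k \<in> ?K" for z k
  proof -
    have ohm: "real (p i) * z (Inl i) = (\<Sum>v\<in>V. inc i v * z (Inr v))" if "i \<in> I" for i
      using z[of "Inl i"] row_Inl[OF that, of z] that by auto
    have current: "(\<Sum>i\<in>I. real (q i) * inc i v * z (Inl i)) = 0" if "v \<in> V" for v
      using z[of "Inr v"] row_Inr[of v z] that by auto
    \<comment> \<open>Energy identity: Ohm's law and regrouping by vertices express the dissipated
      energy through the net currents, which all vanish. As \<open>p i\<close> and
      \<open>q i\<close> are positive, every \<open>z (Inl i)\<close> is 0.\<close>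
    have "(\<Sum>i\<in>I. real (q i) * real (p i) * (z (Inl i))\<^sup>2) =
        (\<Sum>i\<in>I. real (q i) * z (Inl i) * (real (p i) * z (Inl i)))"
      by (intro sum.cong) (auto simp: power2_eq_square)
    also have "\<dots> = (\<Sum>i\<in>I. \<Sum>v\<in>V. real (q i) * z (Inl i) * (inc i v * z (Inr v)))"
      by (intro sum.cong) (simp_all only: ohm sum_distrib_left)
    also have "\<dots> = (\<Sum>v\<in>V. \<Sum>i\<in>I. real (q i) * z (Inl i) * (inc i v * z (Inr v)))"
      by (rule sum.swap)
    also have "\<dots> = (\<Sum>v\<in>V. (\<Sum>i\<in>I. real (q i) * inc i v * z (Inl i)) * z (Inr v))"
      unfolding sum_distrib_right by (intro sum.cong) (auto simp: mult_ac)
    also have "\<dots> = 0" using current by simp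
    finally have "\<forall>i\<in>I. real (q i) * real (p i) * (z (Inl i))\<^sup>2 = 0"
      by (subst (asm) sum_nonneg_eq_0_iff) (use fin in auto)
    then have edge: "z (Inl i) = 0" if "i \<in> I" for i using that pq[OF that] by auto
    have vertex: "z (Inr v) = 0" if "v \<in> V" for v
    proof (rule ccontr)
      assume "z (Inr v) \<noteq> 0"
      \<comment> \<open>Without currents, the two ends of a tile have equal potential. A tile whose
        top is the lowest level of nonzero potential would have its bottom at a still lower such
        level, since the bottom cannot be grounded.\<close>
      define S where "S = {v \<in> V. z (Inr v) \<noteq> 0}"
      have S: "finite S" "S \<noteq> {}" using V that \<open>z (Inr v) \<noteq> 0\<close> by (auto simp: S_def)
      have "Min S \<in> S" by (rule Min_in[OF S])
      then obtain i where i: "i \<in> I" "d i = Min S" using V_top by (auto simp: S_def)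
      then have "z (Inr (Min S)) = (if c i = C then 0 else z (Inr (c i)))"
        using ohm[OF i(1)] sum_inc[OF i(1), of "\<lambda>v. z (Inr v)"] edge[OF i(1)] by simp
      then have "c i \<noteq> C" "z (Inr (c i)) \<noteq> 0" using \<open>Min S \<in> S\<close> by (auto simp: S_def split: if_splits)
      then have "c i \<in> S" using cV[OF i(1)] by (simp add: S_def)
      then have "d i \<le> c i" using i(2) S(1) by simp
      with cd[OF i(1)] show False by simp
    qed
    from k edge vertex show "z k = 0" by auto
  qed

  have abs_inc: "\<bar>inc i v\<bar> \<le> of_bool (c i = v) + of_bool (d i = v)" for i v
    by (auto simp: inc_def)
  have deg_eq: "real (deg v) = (\<Sum>i\<in>I. of_bool (c i = v) + of_bool (d i = v))" for v
    using fin by (simp add: deg_def sum.distrib Int_def)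
  have col: "(\<Sum>r\<in>?K. \<bar>M r k\<bar>) \<le> bnd k" if "k \<in> ?K" for k
  proof (cases k)
    case (Inl i)
    then have i: "i \<in> I" using that by auto
    have "(\<Sum>j\<in>I. \<bar>real (p j) * of_bool (j = i)\<bar>) = real (p i)"
      using fin i by (simp add: of_bool_def if_distrib[of "\<lambda>t. _ * t"] if_distrib[of abs] cong: if_cong)
    moreover have "(\<Sum>v\<in>V. \<bar>inc i v\<bar>) \<le> (\<Sum>v\<in>V. of_bool (c i = v) * 1 + of_bool (d i = v) * 1)"
      using abs_inc by (intro sum_mono) simp
    then have "(\<Sum>v\<in>V. \<bar>inc i v\<bar>) \<le> 2"
      unfolding sum.distrib sum_of_bool_mult_eq[OF V] by (auto split: if_splits)
    then have "real (q i) * (\<Sum>v\<in>V. \<bar>inc i v\<bar>) \<le> real (q i) * 2"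
      by (intro mult_left_mono) auto
    ultimately show ?thesis
      unfolding sum_K by (simp add: Inl M_def bnd_def abs_mult flip: sum_distrib_left)
  next
    case (Inr v)
    then show ?thesis
      unfolding sum_K using abs_inc by (simp add: M_def bnd_def deg_eq sum_mono)
  qed
  have bnd1: "1 \<le> bnd k" if "k \<in> ?K" for k
  proof (cases k)
    case (Inl i)
    then have "p i > 0" using that pq by auto
    then show ?thesis by (simp add: Inl bnd_def max_def)
  next
    case (Inr v)
    then have "{i \<in> I. d i = v} \<noteq> {}" using that V_top by auto
    then have "card {i \<in> I. d i = v} > 0" using fin by (simp add: card_gt_0_iff)
    then show ?thesis by (simp add: Inr bnd_def deg_def)
  qed
  have rhs1: "(\<Sum>r\<in>?K. \<bar>rhs r\<bar>) \<le> 1"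
    using sum_of_bool_mult_eq[OF V, of D "\<lambda>_. 1"] by (simp add: sum_K rhs_def eq_commute[of _ D])
  have M_int: "M r k \<in> \<int>" for r k by (auto simp: M_def inc_def split: sum.split)
  have rhs_int: "rhs r \<in> \<int>" for r by (auto simp: rhs_def split: sum.split)
  obtain \<Delta> where \<Delta>: "\<Delta> > 0" "\<Delta> \<le> (\<Prod>k\<in>?K. bnd k)"
    "\<And>k. k \<in> ?K \<Longrightarrow> \<Delta> * x k \<in> \<int>" "\<And>k. k \<in> ?K \<Longrightarrow> \<bar>\<Delta> * x k\<bar> \<le> (\<Prod>k\<in>?K. bnd k)"
  proof (rule integral_system_common_denominator[where K = ?K and A = M and b = rhs and B = bnd and x = x])
    show "z k = 0" if "\<And>r. r \<in> ?K \<Longrightarrow> (\<Sum>k\<in>?K. M r k * z k) = 0" "k \<in> ?K" for z k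
      using that by (rule inj)
  qed (auto intro: fin V M_int rhs_int col bnd1 rhs1 sol)

  have bound: "(\<Prod>k\<in>?K. bnd k) \<le> 8 ^ card I * (\<Prod>i\<in>I. real (max (p i) (q i)))"
  proof -
    define G where "G = (\<Prod>v\<in>V. deg v)"
    have "G ^ 3 \<le> 9 ^ card I" unfolding G_def deg_def by (rule prod_degrees_le[OF fin V])
    moreover have swap: "(m ^ card I) ^ 3 = (m ^ 3) ^ card I" for m :: nat
      unfolding power_mult[symmetric] by (simp only: mult.commute)
    \<comment> \<open>Cubing keeps the estimate within the natural numbers:
      \<open>3 ^ 3 * 9 = 243 \<le> 512 = 8 ^ 3\<close>.\<close>
    ultimately have "(3 ^ card I * G) ^ 3 \<le> (3 ^ card I) ^ 3 * 9 ^ card I" by (simp add: power_mult_distrib)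
    also have "\<dots> = 243 ^ card I"
      unfolding swap by (simp flip: power_mult_distrib)
    also have "\<dots> \<le> 512 ^ card I" by (rule power_mono) auto
    also have "\<dots> = (8 ^ card I) ^ 3"
      unfolding swap by simp
    finally have "3 ^ card I * G \<le> 8 ^ card I" by (subst (asm) power_mono_iff) auto
    then have "real (3 ^ card I * G) \<le> real (8 ^ card I)" by (rule of_nat_mono)
    then have "3 ^ card I * real G * (\<Prod>i\<in>I. real (max (p i) (q i)))
        \<le> 8 ^ card I * (\<Prod>i\<in>I. real (max (p i) (q i)))"
      by (intro mult_right_mono) (auto intro: prod_nonneg)
    moreover have "(\<Prod>k\<in>?K. bnd k) = 3 ^ card I * real G * (\<Prod>i\<in>I. real (max (p i) (q i)))"
      unfolding prod.Plus[OF fin V] by (simp add: bnd_def G_def prod.distrib)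
    ultimately show ?thesis by simp
  qed

  define l where "l = \<Delta> / (B - A)"
  \<comment> \<open>With \<open>s i\<close> as the unknown, both sides are integer multiples of one
    integer, so a single integrality statement covers width and height.\<close>
  have width: "l * (b i - a i) = real (q i) * (\<Delta> * x (Inl i))"
    and height: "l * (d i - c i) = real (p i) * (\<Delta> * x (Inl i))" if "i \<in> I" for i
  proof -
    have "d i - c i = real (p i) * (b i - a i) / real (q i)"
      using ratio[OF that] ab[OF that] by (simp add: field_simps)
    then show "l * (b i - a i) = real (q i) * (\<Delta> * x (Inl i))"
      and "l * (d i - c i) = real (p i) * (\<Delta> * x (Inl i))"
      using pq[OF that] AB by (simp_all add: l_def x_def mult_ac)
  qed
  show thesis
  proof
    show "l > 0" using \<Delta>(1) AB by (simp add: l_def)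
    \<comment> \<open>The scaled width of the rectangle is \<Delta> itself. The scaled height is
      \<Delta> times the potential at \<open>D\<close>, for which Cramer's rule gives the same
      bound.\<close>
    show "l * (B - A) \<le> 8 ^ card I * (\<Prod>i\<in>I. real (max (p i) (q i)))"
      using \<Delta>(2) bound AB by (simp add: l_def)
    have "l * (D - C) = \<Delta> * x (Inr D)" by (simp add: l_def x_def)
    then show "l * (D - C) \<le> 8 ^ card I * (\<Prod>i\<in>I. real (max (p i) (q i)))"
      using \<Delta>(4)[OF InrI[OF DV]] bound by linarith
    show "l * (b i - a i) \<in> \<int>" "l * (d i - c i) \<in> \<int>" if "i \<in> I" for i
      unfolding width[OF that] height[OF that] using \<Delta>(3)[OF InlI[OF that]] by (simp_all add: Ints_mult)
  qed
qed

end

section \<open>From boxes in the plane to coordinates\<close>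

lemma mem_cbox_real2:
  "x \<in> cbox a b \<longleftrightarrow> a $h 1 \<le> x $h 1 \<and> x $h 1 \<le> b $h 1 \<and> a $h 2 \<le> x $h 2 \<and> x $h 2 \<le> b $h 2"
  for x :: "real^2"
  by (auto simp: mem_box_cart forall_2)

lemma mem_box_real2:
  "x \<in> box a b \<longleftrightarrow> a $h 1 < x $h 1 \<and> x $h 1 < b $h 1 \<and> a $h 2 < x $h 2 \<and> x $h 2 < b $h 2"
  for x :: "real^2"
  by (auto simp: mem_box_cart forall_2)

lemma sides_scaled_cbox:
  fixes a b :: "real^2"
  assumes "a $h 1 < b $h 1" "a $h 2 < b $h 2" "l > 0"
  shows "horizontal_side ((\<lambda>x. l *\<^sub>R x) ` cbox a b) = l * (b $h 1 - a $h 1)"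
    and "vertical_side ((\<lambda>x. l *\<^sub>R x) ` cbox a b) = l * (b $h 2 - a $h 2)"
proof -
  have "cbox a b \<noteq> {}" using assms by (auto simp: set_eq_iff mem_cbox_real2 intro!: exI[of _ a])
  then have "(\<lambda>x. l *\<^sub>R x) ` cbox a b = cbox (l *\<^sub>R a) (l *\<^sub>R b)"
    using assms by (simp add: image_smult_cbox)
  then show "horizontal_side ((\<lambda>x. l *\<^sub>R x) ` cbox a b) = l * (b $h 1 - a $h 1)"
    and "vertical_side ((\<lambda>x. l *\<^sub>R x) ` cbox a b) = l * (b $h 2 - a $h 2)"
    using sides_cbox[of "l *\<^sub>R a" "l *\<^sub>R b"] assms by (simp_all add: right_diff_distrib)
qed

theorem theorem5p4:
  fixes Q :: "(real^2) set" and R :: "nat \<Rightarrow> (real^2) set"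
    and n :: nat and p q :: "nat \<Rightarrow> nat"
  assumes "axis_rectangle Q"
    and "\<And>i. i \<in> {1..n} \<Longrightarrow> axis_rectangle (R i)"
    and "is_tiling {1..n} R Q"
    and "\<And>i. i \<in> {1..n} \<Longrightarrow> p i > 0 \<and> q i > 0"
    and "\<And>i. i \<in> {1..n} \<Longrightarrow>
           vertical_side (R i) / horizontal_side (R i) = real (p i) / real (q i)"
  shows "\<exists>l::real. l > 0 \<and>
     max (horizontal_side ((\<lambda>x. l *\<^sub>R x) ` Q)) (vertical_side ((\<lambda>x. l *\<^sub>R x) ` Q))
       \<le> 8 ^ n * (\<Prod>i=1..n. real (max (p i) (q i))) \<and>
     (\<forall>i\<in>{1..n}. horizontal_side ((\<lambda>x. l *\<^sub>R x) ` R i) \<in> \<int> \<and>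
                 vertical_side ((\<lambda>x. l *\<^sub>R x) ` R i) \<in> \<int>)"
proof -
  obtain e f where Q: "e $h 1 < f $h 1" "e $h 2 < f $h 2" "Q = cbox e f"
    using assms(1) by (auto simp: axis_rectangle_def)
  have "\<forall>i. \<exists>e f. i \<in> {1..n} \<longrightarrow> e $h 1 < f $h 1 \<and> e $h 2 < f $h 2 \<and> R i = cbox e f"
    using assms(2) unfolding axis_rectangle_def by blast
  then obtain u v where R: "u i $h 1 < v i $h 1" "u i $h 2 < v i $h 2" "R i = cbox (u i) (v i)"
    if "i \<in> {1..n}" for i
    by metis
  have union: "(\<Union>i\<in>{1..n}. R i) = Q"
    and disjoint: "disjoint_family_on (\<lambda>i. interior (R i)) {1..n}"
    using assms(3) by (auto simp: is_tiling_def)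
  interpret rectangle_tiling "{1..n}" "\<lambda>i. u i $h 1" "\<lambda>i. v i $h 1" "\<lambda>i. u i $h 2" "\<lambda>i. v i $h 2"
    "e $h 1" "f $h 1" "e $h 2" "f $h 2"
  proof
    fix x y :: real
    \<comment> \<open>Testing membership of this point turns the union and the disjoint interiors
      into the coordinate inequalities of the locale.\<close>
    let ?z = "vector [x, y] :: real^2"
    have "(\<exists>i\<in>{1..n}. ?z \<in> R i) \<longleftrightarrow> ?z \<in> Q" using union by blast
    then show "(\<exists>i\<in>{1..n}. u i $h 1 \<le> x \<and> x \<le> v i $h 1 \<and> u i $h 2 \<le> y \<and> y \<le> v i $h 2) \<longleftrightarrow>
        e $h 1 \<le> x \<and> x \<le> f $h 1 \<and> e $h 2 \<le> y \<and> y \<le> f $h 2"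
      using R(3) unfolding Q(3) by (auto simp: mem_cbox_real2)
    fix i j assume ij: "i \<in> {1..n}" "j \<in> {1..n}"
      "u i $h 1 < x" "x < v i $h 1" "u i $h 2 < y" "y < v i $h 2"
      "u j $h 1 < x" "x < v j $h 1" "u j $h 2 < y" "y < v j $h 2"
    then have "?z \<in> interior (R i) \<inter> interior (R j)"
      using R(3) by (simp add: interior_cbox mem_box_real2)
    then show "i = j" using disjoint ij(1,2) unfolding disjoint_family_on_def by blast
  qed (use Q R in auto)
  obtain l where l: "l > 0"
    "l * (f $h 1 - e $h 1) \<le> 8 ^ card {1..n} * (\<Prod>i\<in>{1..n}. real (max (p i) (q i)))"
    "l * (f $h 2 - e $h 2) \<le> 8 ^ card {1..n} * (\<Prod>i\<in>{1..n}. real (max (p i) (q i)))"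
    "\<And>i. i \<in> {1..n} \<Longrightarrow> l * (v i $h 1 - u i $h 1) \<in> \<int>"
    "\<And>i. i \<in> {1..n} \<Longrightarrow> l * (v i $h 2 - u i $h 2) \<in> \<int>"
  proof (rule integral_scaling[of p q])
    fix i assume i: "i \<in> {1..n}"
    show "p i > 0 \<and> q i > 0" by (rule assms(4)[OF i])
    show "(v i $h 2 - u i $h 2) / (v i $h 1 - u i $h 1) = real (p i) / real (q i)"
      using assms(5)[OF i] sides_cbox[OF R(1,2)[OF i]] R(3)[OF i] by simp
  qed blast
  show ?thesis
  proof (intro exI[of _ l] conjI ballI)
    show "max (horizontal_side ((\<lambda>x. l *\<^sub>R x) ` Q)) (vertical_side ((\<lambda>x. l *\<^sub>R x) ` Q))
        \<le> 8 ^ n * (\<Prod>i=1..n. real (max (p i) (q i)))"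
      using l(2,3) unfolding Q(3) sides_scaled_cbox[OF Q(1,2) l(1)] by simp
    fix i assume i: "i \<in> {1..n}"
    show "horizontal_side ((\<lambda>x. l *\<^sub>R x) ` R i) \<in> \<int>" "vertical_side ((\<lambda>x. l *\<^sub>R x) ` R i) \<in> \<int>"
      using l(4,5)[OF i] unfolding R(3)[OF i] sides_scaled_cbox[OF R(1,2)[OF i] l(1)] by simp_all
  qed (rule l(1))
qed

end
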